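(* Let $G_0=P_{n_1}\,\Box\,P_{n_2}$ be a grid of dimension $n_1\times n_2$. For any Laplacian eigenvalue $\lambda$ of $G_0$, of geometric multiplicity $\mu$, let $$V_\lambda=\Big\{v\in\mathbb R^{n_1 n_2}\;:\;v=\sum_{i=1}^{\mu}\alpha_i\,(v_i\otimes w_i),\ \alpha_i\in\mathbb R\Big\}$$ be the associated eigenspace, where $\lambda=\lambda_{i,1}+\lambda_{i,2}$, $i\in\{1,\dots,\mu\}$, with $v_i$ an eigenvector of the Laplacian of $P_{n_1}$ for $\lambda_{i,1}$ and $w_i$ an eigenvector of the Laplacian of $P_{n_2}$ for $\lambda_{i,2}$. Then each basis eigenvector $v_i\otimes w_i$ generating $V_\lambda$ satisfies one of the four relations: $$\begin{aligned} (v_i\otimes w_i)&=\phantom{-}(\Pi\otimes I)(v_i\otimes w_i)=\phantom{-}(I\otimes\Pi)(v_i\otimes w_i),\\ (v_i\otimes w_i)&=\phantom{-}(\Pi\otimes I)(v_i\otimes w_i)=-(I\otimes\Pi)(v_i\otimes w_i),\\ (v_i\otimes w_i)&=-(\Pi\otimes I)(v_i\otimes w_i)=\phantom{-}(I\otimes\Pi)(v_i\otimes w_i),\\ (v_i\otimes w_i)&=-(\Pi\otimes I)(v_i\otimes w_i)=-(I\otimes\Pi)(v_i\otimes w_i). \end{aligned}$$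
   Context: The path graph $P_n$ of length $n$ has node set $\{1,\dots,n\}$ and edges $(i,i+1)$, $1\le i\le n-1$. The Laplacian of a graph is $L=D-A$. $P_{n_1}\Box P_{n_2}$ denotes the Cartesian product of graphs. $\Pi$ denotes the permutation matrix (of the appropriate size) reversing the components of a vector, $I$ the identity matrix of the appropriate size; so $\Pi\otimes I=\Pi_{n_1}\otimes I_{n_2}$ and $I\otimes\Pi=I_{n_1}\otimes\Pi_{n_2}$. *)

theory Defs
  imports
    "Graph_Theory.Pair_Digraph"
    "Jordan_Normal_Form.Char_Poly"
    "Jordan_Normal_Form.Matrix_Kernel"
begin

text \<open>A simple undirected graph is a finite, symmetric, loop-free pair digraph
  (locale \<^locale>\<open>pair_graph\<close>): each undirected edge is represented by its two arcs.\<close>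

definition path_graph :: "nat \<Rightarrow> nat pair_pre_digraph" where
  "path_graph n = \<lparr> pverts = {1..n},
     parcs = (\<Union>i\<in>{i. 1 \<le> i \<and> i + 1 \<le> n}. {(i, i + 1), (i + 1, i)}) \<rparr>"

definition cartesian_product ::
    "'a pair_pre_digraph \<Rightarrow> 'b pair_pre_digraph \<Rightarrow> ('a \<times> 'b) pair_pre_digraph"
    (infixl "\<box>" 70) where
  "G \<box> H = \<lparr> pverts = pverts G \<times> pverts H,
     parcs = {((a, b), (a', b')). a \<in> pverts G \<and> a' \<in> pverts G \<and> b \<in> pverts H \<and> b' \<in> pverts H \<and>
       (a = a' \<and> (b, b') \<in> parcs H \<or> (a, a') \<in> parcs G \<and> b = b')} \<rparr>"

lemma pair_graph_path_graph: "pair_graph (path_graph n)"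
proof -
  have "parcs (path_graph n) \<subseteq> {1..n} \<times> {1..n}"
    by (auto simp: path_graph_def)
  then have "finite (parcs (path_graph n))"
    by (rule finite_subset) simp
  then show ?thesis
    by unfold_locales (auto simp: path_graph_def symmetric_def sym_def)
qed

lemma pair_graph_cartesian_product:
  assumes "pair_graph G" "pair_graph H"
  shows "pair_graph (G \<box> H)"
proof -
  interpret G: pair_graph G by fact
  interpret H: pair_graph H by fact
  have "parcs (G \<box> H) \<subseteq> (pverts G \<times> pverts H) \<times> (pverts G \<times> pverts H)"
    by (auto simp: cartesian_product_def)
  then have "finite (parcs (G \<box> H))"
    by (rule finite_subset) (simp add: G.pair_finite_verts H.pair_finite_verts)
  then show ?thesis
    using G.pair_sym_arcs H.pair_sym_arcs G.pair_no_loops H.pair_no_loops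
      G.pair_finite_verts H.pair_finite_verts
    by unfold_locales (fastforce simp: cartesian_product_def symmetric_def sym_def)+
qed

text \<open>The matrices of a graph depend on an enumeration \<open>vs\<close> of its nodes: row and column
  \<open>i\<close> (counted from 0) belong to the node \<open>vs ! i\<close>.\<close>

definition degree_matrix :: "'a list \<Rightarrow> 'a pair_pre_digraph \<Rightarrow> real mat" where
  "degree_matrix vs G = mat (length vs) (length vs)
     (\<lambda>(i, j). if i = j then real (out_degree (with_proj G) (vs ! i)) else 0)"

definition adjacency_matrix :: "'a list \<Rightarrow> 'a pair_pre_digraph \<Rightarrow> real mat" where
  "adjacency_matrix vs G = mat (length vs) (length vs)
     (\<lambda>(i, j). if (vs ! i, vs ! j) \<in> parcs G then 1 else 0)"

definition laplacian_matrix :: "'a list \<Rightarrow> 'a pair_pre_digraph \<Rightarrow> real mat" where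
  "laplacian_matrix vs G = degree_matrix vs G - adjacency_matrix vs G"

definition path_laplacian :: "nat \<Rightarrow> real mat" where
  "path_laplacian n = laplacian_matrix [1..<n + 1] (path_graph n)"

text \<open>The nodes of the grid are enumerated lexicographically. This is the enumeration for which
  the component of \<open>v \<otimes> w\<close> at the node \<open>(a, b)\<close> is \<open>v\<^sub>a w\<^sub>b\<close>.\<close>

definition grid_laplacian :: "nat \<Rightarrow> nat \<Rightarrow> real mat" where
  "grid_laplacian n1 n2 =
     laplacian_matrix (List.product [1..<n1 + 1] [1..<n2 + 1]) (path_graph n1 \<box> path_graph n2)"

definition eigenspace :: "real mat \<Rightarrow> real \<Rightarrow> real vec set" where
  "eigenspace A k = mat_kernel (char_matrix A k)"

definition geometric_multiplicity :: "real mat \<Rightarrow> real \<Rightarrow> nat" where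
  "geometric_multiplicity A k = kernel_dim (char_matrix A k)"

lemma mem_eigenspace_iff:
  assumes "A \<in> carrier_mat n n"
  shows "v \<in> eigenspace A k \<longleftrightarrow> v \<in> carrier_vec n \<and> A *\<^sub>v v = k \<cdot>\<^sub>v v"
proof (cases "v = 0\<^sub>v n")
  case True
  then show ?thesis
    using assms by (auto simp: eigenspace_def mat_kernel_def char_matrix_def)
next
  case False
  then show ?thesis
    using assms eigenvector_char_matrix[OF assms, of v k]
    by (auto simp: eigenspace_def mat_kernel_def eigenvector_def char_matrix_def)
qed

definition kron_vec :: "real vec \<Rightarrow> real vec \<Rightarrow> real vec" (infixl "\<otimes>\<^sub>v" 75) where
  "v \<otimes>\<^sub>v w = vec (dim_vec v * dim_vec w) (\<lambda>k. v $ (k div dim_vec w) * w $ (k mod dim_vec w))"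

definition kron_mat :: "real mat \<Rightarrow> real mat \<Rightarrow> real mat" (infixl "\<otimes>\<^sub>m" 75) where
  "A \<otimes>\<^sub>m B = mat (dim_row A * dim_row B) (dim_col A * dim_col B)
     (\<lambda>(i, j). A $$ (i div dim_row B, j div dim_col B) * B $$ (i mod dim_row B, j mod dim_col B))"

definition reversal_matrix :: "nat \<Rightarrow> real mat" where
  "reversal_matrix n = mat n n (\<lambda>(i, j). if i + j + 1 = n then 1 else 0)"

end

(* The equation L v = k v for the path Laplacian determines v from its first entry, so path
   eigenspaces are lines. The reversal \<Pi> maps such a line to itself and \<Pi>\<^sup>2 = I,
   so it acts on it as 1 or -1. *)

theory Submission
  imports Defs
begin

section \<open>Entries of the path Laplacian and the recurrence for its eigenvectors\<close>

lemma arc_path_graph_iff: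
  "(x, y) \<in> parcs (path_graph n) \<longleftrightarrow> x \<in> {1..n} \<and> y \<in> {1..n} \<and> (y = x + 1 \<or> x = y + 1)"
  by (auto simp: path_graph_def)

text \<open>Nodes count from 1 and matrix rows from 0, so row \<open>i\<close> belongs to node
  \<open>i + 1\<close>. The two summands count its left and its right neighbour.\<close>

lemma out_degree_path_graph:
  assumes "i < n"
  shows "out_degree (with_proj (path_graph n)) (i + 1) = of_bool (0 < i) + of_bool (i + 1 < n)"
proof -
  have "out_arcs (with_proj (path_graph n)) (i + 1) =
      (if 0 < i then {(i + 1, i)} else {}) \<union> (if i + 1 < n then {(i + 1, i + 2)} else {})"
    using assms by (auto simp: out_arcs_def arc_path_graph_iff)
  then show ?thesis
    by (simp add: out_degree_def)
qed

lemma path_laplacian_carrier: "path_laplacian n \<in> carrier_mat n n"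
  by (rule carrier_matI) (simp_all add: path_laplacian_def laplacian_matrix_def degree_matrix_def
      adjacency_matrix_def del: upt_Suc)

text \<open>As a function of \<open>j\<close>, each of the three terms is supported at a single
  column, so that the sum in a matrix-vector product collapses term by term.\<close>

lemma index_path_laplacian:
  assumes "i < n" "j < n"
  shows "path_laplacian n $$ (i, j) =
    (if j = i then of_bool (0 < i) + of_bool (i + 1 < n) else 0)
    - (if j + 1 = i then 1 else 0) - (if j = i + 1 then 1 else 0)"
proof -
  have "path_laplacian n $$ (i, j) =
      (if i = j then real (out_degree (with_proj (path_graph n)) (i + 1)) else 0)
      - (if (i + 1, j + 1) \<in> parcs (path_graph n) then 1 else 0)"
    using assms by (simp add: path_laplacian_def laplacian_matrix_def degree_matrix_def
        adjacency_matrix_def nth_upt del: upt_Suc)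
  moreover have "(i + 1, j + 1) \<in> parcs (path_graph n) \<longleftrightarrow> j = i + 1 \<or> j + 1 = i"
    using assms unfolding arc_path_graph_iff by auto
  ultimately show ?thesis
    unfolding out_degree_path_graph[OF assms(1)] by simp
qed

lemma path_laplacian_mult_vec_index:
  assumes "v \<in> carrier_vec n" "i < n"
  shows "(path_laplacian n *\<^sub>v v) $ i =
    (if 0 < i then v $ i - v $ (i - 1) else 0) + (if i + 1 < n then v $ i - v $ (i + 1) else 0)"
proof -
  have "(path_laplacian n *\<^sub>v v) $ i = (\<Sum>j<n. path_laplacian n $$ (i, j) * v $ j)"
    using assms path_laplacian_carrier[of n] by (simp add: scalar_prod_def lessThan_atLeast0)
  also have "\<dots> = (\<Sum>j<n. (if j = i then (of_bool (0 < i) + of_bool (i + 1 < n)) * v $ j else 0)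
      - (if j + 1 = i then v $ j else 0) - (if j = i + 1 then v $ j else 0))"
    using assms by (intro sum.cong) (auto simp: index_path_laplacian)
  also have "\<dots> = (of_bool (0 < i) + of_bool (i + 1 < n)) * v $ i
      - (\<Sum>j<n. if j + 1 = i then v $ j else 0) - (if i + 1 < n then v $ (i + 1) else 0)"
    using assms by (simp add: sum_subtractf)
  \<comment> \<open>For \<open>i = 0\<close> no \<open>j\<close> qualifies. Otherwise the condition
    pins \<open>j\<close> to the predecessor of \<open>i\<close>.\<close>
  also have "(\<Sum>j<n. if j + 1 = i then v $ j else 0) = (if 0 < i then v $ (i - 1) else 0)"
    using assms by (cases i) auto
  finally show ?thesis
    using assms by (auto simp: algebra_simps)
qed

lemma path_eigenvector_index:
  assumes "eigenvector (path_laplacian n) v k" "i < n"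
  shows "(if 0 < i then v $ i - v $ (i - 1) else 0) + (if i + 1 < n then v $ i - v $ (i + 1) else 0)
    = k * v $ i"
proof -
  have v: "v \<in> carrier_vec n" and "path_laplacian n *\<^sub>v v = k \<cdot>\<^sub>v v"
    using assms(1) path_laplacian_carrier[of n] by (auto simp: eigenvector_def)
  then show ?thesis
    using path_laplacian_mult_vec_index[OF v assms(2)] assms(2) by simp
qed

text \<open>Each row with a right neighbour expresses \<open>h (i + 1)\<close> through
  \<open>h i\<close> and \<open>h (i - 1)\<close>, so the zero at the left end propagates. Stating
  it for functions allows its use on a linear combination of two solutions.\<close>

lemma path_recurrence_zero:
  fixes h :: "nat \<Rightarrow> real"
  assumes "\<And>i. i + 1 < n \<Longrightarrow> (if 0 < i then h i - h (i - 1) else 0) + (h i - h (i + 1)) = k * h i"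
    and "h 0 = 0" "i < n"
  shows "h i = 0"
  using \<open>i < n\<close>
proof (induction i rule: less_induct)
  case (less i)
  show ?case
  proof (cases i)
    case 0
    then show ?thesis using assms(2) by simp
  next
    case (Suc m)
    \<comment> \<open>For \<open>m = 0\<close> truncated subtraction makes \<open>m - 1\<close>
      equal to 0, so both indices lie below \<open>i\<close> in every case.\<close>
    then have "h m = 0" "h (m - 1) = 0"
      using less by auto
    then show ?thesis
      using assms(1)[of m] less.prems Suc by (auto split: if_splits)
  qed
qed

section \<open>Reversal acts on path eigenvectors by a sign\<close>

lemma reversal_matrix_carrier: "reversal_matrix n \<in> carrier_mat n n"
  by (simp add: reversal_matrix_def)

lemma reversal_matrix_mult_vec:
  assumes "v \<in> carrier_vec n"
  shows "reversal_matrix n *\<^sub>v v = vec n (\<lambda>i. v $ (n - 1 - i))"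
proof (rule eq_vecI)
  fix i assume "i < dim_vec (vec n (\<lambda>i. v $ (n - 1 - i)))"
  then have i: "i < n" by simp
  have "(reversal_matrix n *\<^sub>v v) $ i = (\<Sum>j<n. if j = n - 1 - i then v $ j else 0)"
    using i assms
    by (auto simp: reversal_matrix_def scalar_prod_def lessThan_atLeast0 simp del: sum.delta
        intro!: sum.cong)
  then show "(reversal_matrix n *\<^sub>v v) $ i = vec n (\<lambda>i. v $ (n - 1 - i)) $ i"
    using i by simp
qed (simp add: reversal_matrix_def)

lemma path_eigenvector_reversal:
  assumes "eigenvector (path_laplacian n) v k"
  shows "reversal_matrix n *\<^sub>v v = v \<or> reversal_matrix n *\<^sub>v v = - v"
proof -
  have v: "v \<in> carrier_vec n" "v \<noteq> 0\<^sub>v n"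
    using assms path_laplacian_carrier[of n] by (auto simp: eigenvector_def)
  define f where "f i = v $ i" for i
  define g where "g i = v $ (n - 1 - i)" for i
  have f: "(if 0 < i then f i - f (i - 1) else 0) + (f i - f (i + 1)) = k * f i" if "i + 1 < n" for i
    using path_eigenvector_index[OF assms, of i] that unfolding f_def by simp
  \<comment> \<open>Row \<open>i\<close> for \<open>g\<close> is row \<open>n - 1 - i\<close> for
    \<open>v\<close> with left and right neighbours exchanged. The index identity for the left
    neighbour is guarded by \<open>0 < i\<close>, since it fails at \<open>i = 0\<close> under
    truncated subtraction.\<close>
  have g: "(if 0 < i then g i - g (i - 1) else 0) + (g i - g (i + 1)) = k * g i" if "i + 1 < n" for i
  proof -
    have "n - 1 - (i - 1) = n - 1 - i + 1" if "0 < i"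
      using that \<open>i + 1 < n\<close> by simp
    moreover have "0 < n - 1 - i" "n - 1 - (i + 1) = n - 1 - i - 1"
      "n - 1 - i + 1 < n \<longleftrightarrow> 0 < i" "n - 1 - i < n"
      using that by auto
    ultimately show ?thesis
      using path_eigenvector_index[OF assms, of "n - 1 - i"] by (auto simp: g_def)
  qed
  \<comment> \<open>A zero first entry would force \<open>v\<close> to vanish, which an eigenvector
    does not; hence division by \<open>f 0\<close> is meaningful.\<close>
  have "f 0 \<noteq> 0"
  proof
    assume "f 0 = 0"
    then have "f i = 0" if "i < n" for i
      using path_recurrence_zero[of n f k] f that by blast
    then show False
      using v by (auto simp: f_def)
  qed
  \<comment> \<open>This is the scalar for which \<open>g - c * f\<close> vanishes at 0, the
    starting value required by \<open>path_recurrence_zero\<close>.\<close>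
  define c where "c = g 0 / f 0"
  have g_eq: "g i = c * f i" if "i < n" for i
  proof -
    have "g i - c * f i = 0"
    proof (rule path_recurrence_zero[where h = "\<lambda>i. g i - c * f i"])
      fix i assume "i + 1 < n"
      \<comment> \<open>The recurrence is linear: subtract \<open>c\<close> times the equation for
        \<open>f\<close> from that for \<open>g\<close>.\<close>
      from g[OF this] arg_cong[OF f[OF this], of "\<lambda>x. c * x"]
      show "(if 0 < i then (g i - c * f i) - (g (i - 1) - c * f (i - 1)) else 0)
          + ((g i - c * f i) - (g (i + 1) - c * f (i + 1))) = k * (g i - c * f i)"
        by (auto simp: algebra_simps split: if_splits)
    qed (use \<open>f 0 \<noteq> 0\<close> \<open>i < n\<close> in \<open>auto simp: c_def\<close>)
    then show ?thesis by simp
  qed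
  have rev_v: "reversal_matrix n *\<^sub>v v = c \<cdot>\<^sub>v v"
    using v g_eq by (auto simp: reversal_matrix_mult_vec f_def g_def)
  have "0 < n"
    using v by (cases n) auto
  \<comment> \<open>At the last index \<open>f\<close> and \<open>g\<close> take each other's first
    values. Together with \<open>g 0 = c * f 0\<close> this gives \<open>c * c = 1\<close>.\<close>
  then have "f 0 = c * g 0"
    using g_eq[of "n - 1"] by (simp add: f_def g_def)
  also have "\<dots> = c\<^sup>2 * f 0"
    using g_eq[of 0] \<open>0 < n\<close> by (simp add: power2_eq_square)
  finally have "c = 1 \<or> c = - 1"
    using \<open>f 0 \<noteq> 0\<close> by (simp add: power2_eq_1_iff)
  then show ?thesis
    using rev_v v by auto
qed

section \<open>Kronecker products of matrices and vectors\<close>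

text \<open>Quotient and remainder by \<open>n\<close> enumerate the index pairs lexicographically,
  the order used by \<open>kron_vec\<close>. The range splits into \<open>m\<close> blocks of length
  \<open>n\<close>, one for each quotient.\<close>

lemma sum_div_mod:
  fixes F :: "nat \<Rightarrow> nat \<Rightarrow> 'a :: comm_monoid_add"
  shows "(\<Sum>k<m * n. F (k div n) (k mod n)) = (\<Sum>a<m. \<Sum>b<n. F a b)"
proof -
  have "(\<Sum>k<m * n. F (k div n) (k mod n))
      = (\<Sum>a<m. \<Sum>k = a * n..<a * n + n. F (k div n) (k mod n))"
    using sum.nat_group[of "\<lambda>k. F (k div n) (k mod n)" n m] by (rule sym)
  also have "\<dots> = (\<Sum>a<m. \<Sum>b<n. F a b)"
  proof (rule sum.cong[OF refl])
    fix a
    show "(\<Sum>k = a * n..<a * n + n. F (k div n) (k mod n)) = (\<Sum>b<n. F a b)"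
    proof -
      \<comment> \<open>Moving the block to start at 0 makes the quotient constantly
        \<open>a\<close> and the remainder \<open>b\<close>.\<close>
      have "(\<Sum>k = a * n..<a * n + n. F (k div n) (k mod n))
          = (\<Sum>b<n. F ((b + a * n) div n) ((b + a * n) mod n))"
        using sum.shift_bounds_nat_ivl[of "\<lambda>k. F (k div n) (k mod n)" 0 "a * n" n]
        by (simp only: lessThan_atLeast0 add_0 add.commute[of n])
      then show ?thesis by simp
    qed
  qed
  finally show ?thesis .
qed

text \<open>The mixed-product rule: in each row the summand splits into a factor in \<open>a\<close>
  and a factor in \<open>b\<close>, so the double sum is a product of two sums.\<close>

lemma kron_mat_mult_kron_vec:
  assumes "A \<in> carrier_mat m m'" "B \<in> carrier_mat n n'" "v \<in> carrier_vec m'" "w \<in> carrier_vec n'"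
  shows "(A \<otimes>\<^sub>m B) *\<^sub>v (v \<otimes>\<^sub>v w) = (A *\<^sub>v v) \<otimes>\<^sub>v (B *\<^sub>v w)"
proof (rule eq_vecI)
  fix i assume "i < dim_vec ((A *\<^sub>v v) \<otimes>\<^sub>v (B *\<^sub>v w))"
  then have i: "i < m * n"
    using assms by (simp add: kron_vec_def)
  then have "0 < n" by (cases n) auto
  then have ij: "i div n < m" "i mod n < n"
    using i by (auto simp: less_mult_imp_div_less)
  have "((A \<otimes>\<^sub>m B) *\<^sub>v (v \<otimes>\<^sub>v w)) $ i =
      (\<Sum>k<m' * n'. (A $$ (i div n, k div n') * v $ (k div n')) * (B $$ (i mod n, k mod n') * w $ (k mod n')))"
    using assms i
    by (auto simp: kron_mat_def kron_vec_def scalar_prod_def lessThan_atLeast0 intro!: sum.cong)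
  also have "\<dots> = (\<Sum>a<m'. \<Sum>b<n'. (A $$ (i div n, a) * v $ a) * (B $$ (i mod n, b) * w $ b))"
    by (rule sum_div_mod)
  also have "\<dots> = (\<Sum>a<m'. A $$ (i div n, a) * v $ a) * (\<Sum>b<n'. B $$ (i mod n, b) * w $ b)"
    by (simp add: sum_product)
  also have "\<dots> = ((A *\<^sub>v v) \<otimes>\<^sub>v (B *\<^sub>v w)) $ i"
    using assms i ij by (simp add: kron_vec_def scalar_prod_def lessThan_atLeast0)
  finally show "((A \<otimes>\<^sub>m B) *\<^sub>v (v \<otimes>\<^sub>v w)) $ i = ((A *\<^sub>v v) \<otimes>\<^sub>v (B *\<^sub>v w)) $ i" .
qed (use assms in \<open>simp add: kron_mat_def kron_vec_def\<close>)

lemma kron_vec_uminus_left: "(- v) \<otimes>\<^sub>v w = - (v \<otimes>\<^sub>v w)"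
  by (rule eq_vecI) (simp_all add: kron_vec_def less_mult_imp_div_less)

lemma kron_vec_uminus_right: "v \<otimes>\<^sub>v (- w) = - (v \<otimes>\<^sub>v w)"
proof (rule eq_vecI)
  fix i assume "i < dim_vec (- (v \<otimes>\<^sub>v w))"
  then have "i < dim_vec v * dim_vec w"
    by (simp add: kron_vec_def)
  \<comment> \<open>A positive length keeps \<open>i mod dim_vec w\<close> in range, as evaluating
    the entry of \<open>- w\<close> there requires.\<close>
  moreover from this have "0 < dim_vec w"
    by (cases "dim_vec w") auto
  ultimately show "(v \<otimes>\<^sub>v (- w)) $ i = (- (v \<otimes>\<^sub>v w)) $ i"
    by (simp add: kron_vec_def)
qed (simp add: kron_vec_def)

theorem mainTheorem4:
  fixes n1 n2 \<mu> :: nat and lam :: real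
    and lam1 lam2 :: "nat \<Rightarrow> real" and v w :: "nat \<Rightarrow> real vec"
  defines "R1 \<equiv> reversal_matrix n1 \<otimes>\<^sub>m 1\<^sub>m n2"
    and "R2 \<equiv> 1\<^sub>m n1 \<otimes>\<^sub>m reversal_matrix n2"
  assumes "eigenvalue (grid_laplacian n1 n2) lam"
    and "\<mu> = geometric_multiplicity (grid_laplacian n1 n2) lam"
    and "\<And>i. i \<in> {1..\<mu>} \<Longrightarrow> lam = lam1 i + lam2 i"
    and "\<And>i. i \<in> {1..\<mu>} \<Longrightarrow> eigenvector (path_laplacian n1) (v i) (lam1 i)"
    and "\<And>i. i \<in> {1..\<mu>} \<Longrightarrow> eigenvector (path_laplacian n2) (w i) (lam2 i)"
    and "eigenspace (grid_laplacian n1 n2) lam =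
      {finsum_vec TYPE(real) (n1 * n2) (\<lambda>i. \<alpha> i \<cdot>\<^sub>v (v i \<otimes>\<^sub>v w i)) {1..\<mu>} | \<alpha>. True}"
  shows "\<forall>i\<in>{1..\<mu>}. let u = v i \<otimes>\<^sub>v w i in
    (u = R1 *\<^sub>v u \<and> R1 *\<^sub>v u = R2 *\<^sub>v u) \<or>
    (u = R1 *\<^sub>v u \<and> R1 *\<^sub>v u = - (R2 *\<^sub>v u)) \<or>
    (u = - (R1 *\<^sub>v u) \<and> - (R1 *\<^sub>v u) = R2 *\<^sub>v u) \<or>
    (u = - (R1 *\<^sub>v u) \<and> - (R1 *\<^sub>v u) = - (R2 *\<^sub>v u))"
proof
  fix i assume i: "i \<in> {1..\<mu>}"
  note ev = assms(6,7)[OF i]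
  let ?u = "v i \<otimes>\<^sub>v w i"
  have "v i \<in> carrier_vec n1" "w i \<in> carrier_vec n2"
    using ev path_laplacian_carrier[of n1] path_laplacian_carrier[of n2]
    by (auto simp: eigenvector_def)
  \<comment> \<open>By the mixed-product rule with an identity factor, each grid reflection reverses
    only one tensor factor.\<close>
  then have "R1 *\<^sub>v ?u = (reversal_matrix n1 *\<^sub>v v i) \<otimes>\<^sub>v w i"
    and "R2 *\<^sub>v ?u = v i \<otimes>\<^sub>v (reversal_matrix n2 *\<^sub>v w i)"
    using kron_mat_mult_kron_vec[OF reversal_matrix_carrier one_carrier_mat]
      kron_mat_mult_kron_vec[OF one_carrier_mat reversal_matrix_carrier]
    by (simp_all add: R1_def R2_def)
  \<comment> \<open>The sign of each reversed factor moves out of the tensor product. The two signs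
    are independent, which yields the four cases.\<close>
  then have "R1 *\<^sub>v ?u = ?u \<or> R1 *\<^sub>v ?u = - ?u" "R2 *\<^sub>v ?u = ?u \<or> R2 *\<^sub>v ?u = - ?u"
    using path_eigenvector_reversal[OF ev(1)] path_eigenvector_reversal[OF ev(2)]
    by (auto simp: kron_vec_uminus_left kron_vec_uminus_right)
  then show "let u = v i \<otimes>\<^sub>v w i in
    (u = R1 *\<^sub>v u \<and> R1 *\<^sub>v u = R2 *\<^sub>v u) \<or>
    (u = R1 *\<^sub>v u \<and> R1 *\<^sub>v u = - (R2 *\<^sub>v u)) \<or>
    (u = - (R1 *\<^sub>v u) \<and> - (R1 *\<^sub>v u) = R2 *\<^sub>v u) \<or>
    (u = - (R1 *\<^sub>v u) \<and> - (R1 *\<^sub>v u) = - (R2 *\<^sub>v u))"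
    \<comment> \<open>Double negation turns \<open>R1 *\<^sub>v u = - u\<close> into the required
      form \<open>u = - (R1 *\<^sub>v u)\<close>, and likewise for \<open>R2\<close>.\<close>
    unfolding Let_def by (metis uminus_uminus_vec)
qed

end
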